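(* Let $\widetilde{W_3}^*$ be the $5$-dimensional complex nilpotent metric Leibniz algebra with basis $e_1,\dots,e_5$ and nonzero brackets $[e_3,e_4]=e_2=-[e_4,e_3]$, $[e_3,e_5]=e_1=-[e_5,e_3]$, $[e_4,e_5]=e_3=-[e_5,e_4]$, $[e_5,e_5]=e_2$, $[e_4,e_4]=e_1$. Then $\widetilde{W_3}^*$ has no metric deformation.
   Context: All algebras are over $\mathbb{C}$. A left (resp. right) Leibniz algebra is a vector space $\mathfrak{L}$ with a bilinear bracket satisfying $[x,[y,z]]=[[x,y],z]+[y,[x,z]]$ (resp. $[x,[y,z]]=[[x,y],z]-[[x,z],y]$); a Leibniz algebra is one or the other. A bilinear form $B$ on $\mathfrak{L}$ is invariant if $B([x,y],z)=B(x,[y,z])$ for all $x,y,z$. $\mathfrak{L}$ is metric if it has a non-degenerate symmetric invariant bilinear form. A (formal $1$-parameter, Leibniz) deformation of $(\mathfrak{L},\mu_0)$ is a Leibniz bracket $\mu_t=\mu_0+t\phi_1+t^2\phi_2+\cdots$ on $\mathfrak{L}\otimes\mathbb{C}[[t]]$, with $\phi_i$ bilinear maps $\mathfrak{L}\times\mathfrak{L}\to\mathfrak{L}$. Two deformations $\mu_t,\tilde\mu_t$ are equivalent if $\tilde\mu_t(x,y)=\Phi_t\mu_t(\Phi_t^{-1}x,\Phi_t^{-1}y)$ for some $\Phi_t=\mathrm{id}+t\,\Phi_1+t^2\Phi_2+\cdots$ with linear $\Phi_i$; a deformation equivalent to $\mu_0$ is trivial. A metric deformation is a non-trivial deformation $\mu_t$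 that is a metric Leibniz algebra for $t\neq 0$ (for formal $t$: after extending scalars to $\mathbb{C}((t))$). *)

theory Defs
  imports
    "HOL-Complex_Analysis.Complex_Analysis"
begin

no_notation fps_nth (infixl "$" 75)

section \<open>Metric Leibniz algebras\<close>

text \<open>
  Algebras live on the free module \<^typ>\<open>'k ^ 'n\<close> over a commutative ring \<^typ>\<open>'k\<close>;
  \<^typ>\<open>'k\<close> is the field of complex numbers, the ring of complex power series or the field of
  complex Laurent series. The module structure is always the one given by \<^term>\<open>(*s)\<close>.
\<close>

definition bilinear_bracket ::
    "('k::comm_ring_1 ^ 'n \<Rightarrow> 'k ^ 'n \<Rightarrow> 'k ^ 'n) \<Rightarrow> bool" where
  "bilinear_bracket \<mu> \<longleftrightarrow>
     (\<forall>x. module_hom (*s) (*s) (\<lambda>y. \<mu> x y)) \<and> (\<forall>y. module_hom (*s) (*s) (\<lambda>x. \<mu> x y))"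

definition bilinear_form ::
    "('k::comm_ring_1 ^ 'n \<Rightarrow> 'k ^ 'n \<Rightarrow> 'k) \<Rightarrow> bool" where
  "bilinear_form B \<longleftrightarrow>
     (\<forall>x. module_hom (*s) (*) (\<lambda>y. B x y)) \<and> (\<forall>y. module_hom (*s) (*) (\<lambda>x. B x y))"

definition left_leibniz :: "('a::ab_group_add \<Rightarrow> 'a \<Rightarrow> 'a) \<Rightarrow> bool" where
  "left_leibniz \<mu> \<longleftrightarrow> (\<forall>x y z. \<mu> x (\<mu> y z) = \<mu> (\<mu> x y) z + \<mu> y (\<mu> x z))"

definition right_leibniz :: "('a::ab_group_add \<Rightarrow> 'a \<Rightarrow> 'a) \<Rightarrow> bool" where
  "right_leibniz \<mu> \<longleftrightarrow> (\<forall>x y z. \<mu> x (\<mu> y z) = \<mu> (\<mu> x y) z - \<mu> (\<mu> x z) y)"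

definition leibniz_algebra ::
    "('k::comm_ring_1 ^ 'n \<Rightarrow> 'k ^ 'n \<Rightarrow> 'k ^ 'n) \<Rightarrow> bool" where
  "leibniz_algebra \<mu> \<longleftrightarrow> bilinear_bracket \<mu> \<and> (left_leibniz \<mu> \<or> right_leibniz \<mu>)"

definition invariant_form :: "('a \<Rightarrow> 'a \<Rightarrow> 'a) \<Rightarrow> ('a \<Rightarrow> 'a \<Rightarrow> 'k) \<Rightarrow> bool" where
  "invariant_form \<mu> B \<longleftrightarrow> (\<forall>x y z. B (\<mu> x y) z = B x (\<mu> y z))"

definition symmetric_form :: "('a \<Rightarrow> 'a \<Rightarrow> 'k) \<Rightarrow> bool" where
  "symmetric_form B \<longleftrightarrow> (\<forall>x y. B x y = B y x)"

definition nondegenerate_form :: "('a::zero \<Rightarrow> 'a \<Rightarrow> 'k::zero) \<Rightarrow> bool" where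
  "nondegenerate_form B \<longleftrightarrow> (\<forall>x. (\<forall>y. B x y = 0) \<longrightarrow> x = 0)"

definition metric_leibniz_algebra ::
    "('k::field ^ 'n \<Rightarrow> 'k ^ 'n \<Rightarrow> 'k ^ 'n) \<Rightarrow> bool" where
  "metric_leibniz_algebra \<mu> \<longleftrightarrow> leibniz_algebra \<mu> \<and>
     (\<exists>B. bilinear_form B \<and> symmetric_form B \<and> nondegenerate_form B \<and> invariant_form \<mu> B)"


section \<open>Formal deformations\<close>

text \<open>
  For finite \<^typ>\<open>'n\<close> the module \<open>\<complex>\<^sup>n \<otimes> \<complex>[[t]]\<close> is \<^typ>\<open>complex fps ^ 'n\<close>;
  \<open>vec_coeff x k\<close> is the coefficient of \<open>t\<^sup>k\<close> in \<open>x\<close>.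
\<close>

definition vec_coeff :: "complex fps ^ 'n \<Rightarrow> nat \<Rightarrow> complex ^ 'n" where
  "vec_coeff x k = (\<chi> i. fps_nth (x $ i) k)"

definition vec_series :: "(nat \<Rightarrow> complex ^ 'n) \<Rightarrow> complex fps ^ 'n" where
  "vec_series v = (\<chi> i. Abs_fps (\<lambda>k. v k $ i))"

text \<open>
  The \<open>\<complex>[[t]]\<close>-bilinear map \<open>\<Sum>\<^sub>k t\<^sup>k \<phi>\<^sub>k\<close>: the coefficient of \<open>t\<^sup>m\<close> of its value at
  \<open>(\<Sum>\<^sub>i t\<^sup>i x\<^sub>i, \<Sum>\<^sub>j t\<^sup>j y\<^sub>j)\<close> is the sum of \<open>\<phi>\<^sub>k(x\<^sub>i, y\<^sub>j)\<close> over \<open>k + i + j = m\<close>.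
\<close>

definition bracket_series ::
    "(nat \<Rightarrow> complex ^ 'n \<Rightarrow> complex ^ 'n \<Rightarrow> complex ^ 'n) \<Rightarrow>
     complex fps ^ 'n \<Rightarrow> complex fps ^ 'n \<Rightarrow> complex fps ^ 'n" where
  "bracket_series \<phi> x y = vec_series (\<lambda>m.
     \<Sum>k\<le>m. \<Sum>i\<le>m - k. \<phi> k (vec_coeff x i) (vec_coeff y (m - k - i)))"

text \<open>Likewise the \<open>\<complex>[[t]]\<close>-linear map \<open>\<Sum>\<^sub>k t\<^sup>k \<Phi>\<^sub>k\<close>.\<close>

definition linear_series ::
    "(nat \<Rightarrow> complex ^ 'n \<Rightarrow> complex ^ 'n) \<Rightarrow> complex fps ^ 'n \<Rightarrow> complex fps ^ 'n" where
  "linear_series \<Phi> x = vec_series (\<lambda>m. \<Sum>k\<le>m. \<Phi> k (vec_coeff x (m - k)))"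

text \<open>
  A deformation is given by its sequence of coefficients \<open>\<mu>\<^sub>0, \<phi>\<^sub>1, \<phi>\<^sub>2, \<dots>\<close>.
\<close>

definition leibniz_deformation ::
    "(complex ^ 'n \<Rightarrow> complex ^ 'n \<Rightarrow> complex ^ 'n) \<Rightarrow>
     (nat \<Rightarrow> complex ^ 'n \<Rightarrow> complex ^ 'n \<Rightarrow> complex ^ 'n) \<Rightarrow> bool" where
  "leibniz_deformation \<mu>0 \<phi> \<longleftrightarrow>
     \<phi> 0 = \<mu>0 \<and> (\<forall>k. bilinear_bracket (\<phi> k)) \<and> leibniz_algebra (bracket_series \<phi>)"

text \<open>
  The inverse below is a genuine one: a series of linear maps starting with the identity is
  bijective.
\<close>

definition equivalent_deformations ::
    "(nat \<Rightarrow> complex ^ 'n \<Rightarrow> complex ^ 'n \<Rightarrow> complex ^ 'n) \<Rightarrow>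
     (nat \<Rightarrow> complex ^ 'n \<Rightarrow> complex ^ 'n \<Rightarrow> complex ^ 'n) \<Rightarrow> bool" where
  "equivalent_deformations \<phi> \<psi> \<longleftrightarrow>
     (\<exists>\<Phi>. \<Phi> 0 = id \<and> (\<forall>k. module_hom (*s) (*s) (\<Phi> k)) \<and>
       (\<forall>x y. bracket_series \<psi> x y =
          linear_series \<Phi> (bracket_series \<phi>
            (inv (linear_series \<Phi>) x) (inv (linear_series \<Phi>) y))))"

definition constant_deformation ::
    "(complex ^ 'n \<Rightarrow> complex ^ 'n \<Rightarrow> complex ^ 'n) \<Rightarrow>
     nat \<Rightarrow> complex ^ 'n \<Rightarrow> complex ^ 'n \<Rightarrow> complex ^ 'n" where
  "constant_deformation \<mu>0 k = (if k = 0 then \<mu>0 else (\<lambda>x y. 0))"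

definition trivial_deformation ::
    "(complex ^ 'n \<Rightarrow> complex ^ 'n \<Rightarrow> complex ^ 'n) \<Rightarrow>
     (nat \<Rightarrow> complex ^ 'n \<Rightarrow> complex ^ 'n \<Rightarrow> complex ^ 'n) \<Rightarrow> bool" where
  "trivial_deformation \<mu>0 \<phi> \<longleftrightarrow> equivalent_deformations \<phi> (constant_deformation \<mu>0)"

text \<open>
  Extension of scalars from \<open>\<complex>[[t]]\<close> to \<open>\<complex>((t))\<close>: the \<open>\<complex>((t))\<close>-bilinear bracket with the
  same structure constants in the standard basis.
\<close>

definition laurent_extension ::
    "(complex fps ^ 'n \<Rightarrow> complex fps ^ 'n \<Rightarrow> complex fps ^ 'n) \<Rightarrow>
     complex fls ^ 'n \<Rightarrow> complex fls ^ 'n \<Rightarrow> complex fls ^ 'n" where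
  "laurent_extension \<mu> x y =
     (\<Sum>i\<in>UNIV. \<Sum>j\<in>UNIV.
        (x $ i * y $ j) *s (\<chi> k. fps_to_fls (\<mu> (axis i 1) (axis j 1) $ k)))"

definition metric_deformation ::
    "(complex ^ 'n \<Rightarrow> complex ^ 'n \<Rightarrow> complex ^ 'n) \<Rightarrow>
     (nat \<Rightarrow> complex ^ 'n \<Rightarrow> complex ^ 'n \<Rightarrow> complex ^ 'n) \<Rightarrow> bool" where
  "metric_deformation \<mu>0 \<phi> \<longleftrightarrow>
     leibniz_deformation \<mu>0 \<phi> \<and> \<not> trivial_deformation \<mu>0 \<phi> \<and>
     metric_leibniz_algebra (laurent_extension (bracket_series \<phi>))"


section \<open>The algebra\<close>

text \<open>
  In the index type \<^typ>\<open>5\<close> the numerals \<open>1, 2, 3, 4, 5\<close> are its five distinct elements (\<open>5 = 0\<close>).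
\<close>

abbreviation e :: "5 \<Rightarrow> complex ^ 5" where
  "e i \<equiv> axis i 1"

definition W3_star :: "complex ^ 5 \<Rightarrow> complex ^ 5 \<Rightarrow> complex ^ 5" where
  "W3_star x y =
     (x $ 3 * y $ 4 - x $ 4 * y $ 3) *s e 2 +
     (x $ 3 * y $ 5 - x $ 5 * y $ 3) *s e 1 +
     (x $ 4 * y $ 5 - x $ 5 * y $ 4) *s e 3 +
     (x $ 5 * y $ 5) *s e 2 +
     (x $ 4 * y $ 4) *s e 1"

lemma exhaust_5: "i = 1 \<or> i = 2 \<or> i = 3 \<or> i = 4 \<or> i = 5" for i :: 5
proof (induct i)
  case (of_int z)
  then have "z = 0 \<or> z = 1 \<or> z = 2 \<or> z = 3 \<or> z = 4" by fastforce
  then show ?case by auto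
qed

lemma forall_5: "(\<forall>i::5. P i) \<longleftrightarrow> P 1 \<and> P 2 \<and> P 3 \<and> P 4 \<and> P 5"
  by (metis exhaust_5)

lemma W3_star_nth:
  "W3_star x y $ 1 = x $ 3 * y $ 5 - x $ 5 * y $ 3 + x $ 4 * y $ 4"
  "W3_star x y $ 2 = x $ 3 * y $ 4 - x $ 4 * y $ 3 + x $ 5 * y $ 5"
  "W3_star x y $ 3 = x $ 4 * y $ 5 - x $ 5 * y $ 4"
  "W3_star x y $ 4 = 0"
  "W3_star x y $ 5 = 0"
  by (simp_all add: W3_star_def axis_def)

lemma W3_star_table:
  "W3_star (e i) (e j) =
     (if (i, j) = (3, 4) then e 2 else if (i, j) = (4, 3) then - e 2
      else if (i, j) = (3, 5) then e 1 else if (i, j) = (5, 3) then - e 1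
      else if (i, j) = (4, 5) then e 3 else if (i, j) = (5, 4) then - e 3
      else if (i, j) = (5, 5) then e 2 else if (i, j) = (4, 4) then e 1 else 0)"
  using exhaust_5[of i] exhaust_5[of j]
  by (elim disjE; simp add: vec_eq_iff forall_5 W3_star_nth; simp add: axis_def)

lemma left_leibniz_W3_star: "left_leibniz W3_star"
  unfolding left_leibniz_def by (simp add: vec_eq_iff forall_5 W3_star_nth algebra_simps)

lemma right_leibniz_W3_star: "right_leibniz W3_star"
  unfolding right_leibniz_def by (simp add: vec_eq_iff forall_5 W3_star_nth algebra_simps)

lemma nilpotent_W3_star:
  "W3_star w (W3_star x (W3_star y z)) = 0" "W3_star w (W3_star (W3_star x y) z) = 0"
  "W3_star (W3_star w x) (W3_star y z) = 0" "W3_star (W3_star w (W3_star x y)) z = 0"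
  "W3_star (W3_star (W3_star w x) y) z = 0"
  by (simp_all add: vec_eq_iff forall_5 W3_star_nth)

lemma metric_W3_star: "metric_leibniz_algebra W3_star"
proof -
  define B :: "complex ^ 5 \<Rightarrow> complex ^ 5 \<Rightarrow> complex" where
    "B x y = x $ 3 * y $ 3 + x $ 2 * y $ 5 + x $ 5 * y $ 2 - x $ 1 * y $ 4 - x $ 4 * y $ 1" for x y
  have mod1: "module ((*s) :: complex \<Rightarrow> complex ^ 5 \<Rightarrow> complex ^ 5)"
    by unfold_locales
  have mod2: "module ((*) :: complex \<Rightarrow> complex \<Rightarrow> complex)"
    by unfold_locales (simp_all add: algebra_simps)
  have "bilinear_bracket W3_star"
    unfolding bilinear_bracket_def module_hom_def module_hom_axioms_def using mod1
    by (simp add: vec_eq_iff forall_5 W3_star_nth algebra_simps)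
  moreover have "bilinear_form B"
    unfolding bilinear_form_def module_hom_def module_hom_axioms_def using mod1 mod2
    by (simp add: B_def algebra_simps)
  moreover have "symmetric_form B"
    by (simp add: symmetric_form_def B_def algebra_simps)
  moreover have "invariant_form W3_star B"
    by (simp add: invariant_form_def B_def W3_star_nth algebra_simps)
  moreover have "nondegenerate_form B"
    unfolding nondegenerate_form_def
  proof (intro allI impI)
    fix x assume *: "\<forall>y. B x y = 0"
    have "B x (e 1) = - x $ 4" "B x (e 2) = x $ 5" "B x (e 3) = x $ 3"
      "B x (e 4) = - x $ 1" "B x (e 5) = x $ 2"
      by (simp_all add: B_def axis_def)
    with * show "x = 0" by (simp add: vec_eq_iff forall_5)
  qed
  ultimately show ?thesis
    using left_leibniz_W3_star
    by (auto simp: metric_leibniz_algebra_def leibniz_algebra_def)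
qed

end

theory Submission
  imports Defs
begin

text \<open>
  For a deformation \<open>\<mu>\<close> that is metric over \<open>\<complex>((t))\<close>, a basis with the multiplication table of
  \<open>W3_star\<close> can be found over \<open>\<complex>[[t]]\<close>, so that \<open>\<mu>\<close> is trivial. Clearing denominators, let \<open>B\<close> be a nondegenerate
  invariant form with values in \<open>\<complex>[[t]]\<close>. The Leibniz identity and invariance make all
  \<open>\<mu> x y + \<mu> y x\<close> central, and central elements are orthogonal to all products. For any lifts \<open>a\<close>, \<open>b\<close> of
  \<open>e\<^sub>4\<close>, \<open>e\<^sub>5\<close>, the elements \<open>f\<^sub>1 = \<mu> a a\<close>, \<open>f\<^sub>2 = \<mu> b b\<close>, \<open>f\<^sub>3 = (\<mu> a b - \<mu> b a) / 2\<close>, \<open>a\<close>, \<open>b\<close> form a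
  basis, being one modulo \<open>t\<close>, and the orthogonal complement of \<open>f\<^sub>1, f\<^sub>2, f\<^sub>3\<close> is spanned by
  \<open>f\<^sub>1, f\<^sub>2\<close>. Hence \<open>\<mu> a b + \<mu> b a\<close> is a combination of \<open>f\<^sub>1\<close> and \<open>f\<^sub>2\<close>, and solving a quadratic
  equation over \<open>\<complex>[[t]]\<close> one can choose \<open>a\<close>, \<open>b\<close> so that it vanishes. Then
  \<open>\<mu> f\<^sub>3 a = \<beta> f\<^sub>2\<close> and \<open>\<mu> f\<^sub>3 b = \<gamma> f\<^sub>1\<close>, and rescaling \<open>a\<close>, \<open>b\<close> by \<open>x\<close>, \<open>x\<^sup>2 \<beta>\<close> with
  \<open>x\<^sup>3 \<beta>\<^sup>2 \<gamma> = 1\<close> normalises both constants to \<open>1\<close>.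
\<close>

section \<open>Sums over five indices and roots of power series\<close>

lemma sum_5:
  fixes f :: "5 \<Rightarrow> 'a::comm_monoid_add"
  shows "(\<Sum>i\<in>UNIV. f i) = f 1 + f 2 + f 3 + f 4 + f 5"
proof -
  have "(UNIV :: 5 set) = {1, 2, 3, 4, 5}"
    using exhaust_5 by auto
  then have "sum f UNIV = sum f {1, 2, 3, 4, 5}" by (rule arg_cong)
  also have "\<dots> = f 1 + f 2 + f 3 + f 4 + f 5"
    by (simp add: add.assoc)
  finally show ?thesis .
qed

lemma fps_root_exists:
  fixes a :: "complex fps"
  assumes "fps_nth a 0 = 1" and "n > 0"
  shows "\<exists>x. x ^ n = a \<and> fps_nth x 0 = 1"
proof -
  obtain k where k: "n = Suc k" using assms(2) gr0_conv_Suc by auto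
  \<comment> \<open>The radical takes a function choosing a root of the constant term. That term is
    1 here, and the constant choice 1 is a root of it.\<close>
  have "fps_radical (\<lambda>_ _. 1) (Suc k) a ^ Suc k = a"
    using power_radical[of a "\<lambda>_ _. 1" k] assms(1) by simp
  moreover have "fps_nth (fps_radical (\<lambda>_ _. 1) (Suc k) a) 0 = 1"
    by simp
  ultimately show ?thesis using k by blast
qed

section \<open>Inverting matrices of power series\<close>

text \<open>The coefficients of the left inverse of \<open>\<Sum>\<^sub>k t\<^sup>k g\<^sub>k\<close> when \<open>g\<^sub>0\<close> is the identity.\<close>

fun neumann_coeff :: "(nat \<Rightarrow> 'a::comm_ring_1 ^ 'n ^ 'n) \<Rightarrow> nat \<Rightarrow> 'a ^ 'n ^ 'n" where
  "neumann_coeff g n = (if n = 0 then mat 1 else - (\<Sum>k<n. neumann_coeff g k ** g (n - k)))"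

declare neumann_coeff.simps [simp del]

definition coeff_matrix :: "'a::zero fps ^ 'n ^ 'm \<Rightarrow> nat \<Rightarrow> 'a ^ 'n ^ 'm" where
  "coeff_matrix G k = (\<chi> i j. fps_nth (G $ i $ j) k)"

lemma coeff_matrix_mult:
  fixes A :: "'a::comm_ring_1 fps ^ 'n ^ 'n"
  shows "coeff_matrix (A ** G) n = (\<Sum>k\<le>n. coeff_matrix A k ** coeff_matrix G (n - k))"
proof -
  have "fps_nth (\<Sum>l\<in>UNIV. A $ i $ l * G $ l $ j) n =
      (\<Sum>k\<le>n. \<Sum>l\<in>UNIV. fps_nth (A $ i $ l) k * fps_nth (G $ l $ j) (n - k))" for i j
    by (simp add: fps_sum_nth fps_mult_nth atLeast0AtMost) (rule sum.swap)
  then show ?thesis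
    by (simp add: coeff_matrix_def matrix_matrix_mult_def vec_eq_iff)
qed

lemma coeff_matrix_eqI: "(\<And>k. coeff_matrix A k = coeff_matrix C k) \<Longrightarrow> A = C"
  by (simp add: coeff_matrix_def vec_eq_iff fps_eq_iff)

lemma coeff_matrix_mat_1: "coeff_matrix (mat 1) k = (if k = 0 then mat 1 else 0)"
  by (simp add: coeff_matrix_def mat_def vec_eq_iff)

lemma left_inverse_coeff_matrix:
  fixes G :: "'a::comm_ring_1 fps ^ 'n ^ 'n"
  assumes "coeff_matrix G 0 = mat 1"
  obtains H where "H ** G = mat 1" "coeff_matrix H 0 = mat 1"
proof
  let ?h = "neumann_coeff (coeff_matrix G)"
  define H where "H = (\<chi> i j. Abs_fps (\<lambda>k. ?h k $ i $ j))"
  have H: "coeff_matrix H k = ?h k" for k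
    by (simp add: coeff_matrix_def H_def vec_eq_iff)
  show "coeff_matrix H 0 = mat 1"
    unfolding H by (simp add: neumann_coeff.simps)
  show "H ** G = mat 1"
  proof (rule coeff_matrix_eqI)
    fix n
    show "coeff_matrix (H ** G) n = coeff_matrix (mat 1) n"
    proof (cases n)
      case 0
      then show ?thesis
        by (simp add: coeff_matrix_mult coeff_matrix_mat_1 H neumann_coeff.simps assms)
    next
      case (Suc m)
      then have "coeff_matrix (H ** G) n =
          (\<Sum>k<n. ?h k ** coeff_matrix G (n - k)) + ?h n"
        by (simp add: coeff_matrix_mult H assms lessThan_Suc_atMost [symmetric] )
      also have "\<dots> = 0"
        using Suc by (subst (2) neumann_coeff.simps) simp
      finally show ?thesis using Suc by (simp add: coeff_matrix_mat_1)
    qed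
  qed
qed

text \<open>The left inverse \<open>H\<close> again has constant term the identity, hence has a left
  inverse of its own; by associativity that one is \<open>G\<close>.\<close>

lemma inverse_coeff_matrix:
  fixes G :: "'a::comm_ring_1 fps ^ 'n ^ 'n"
  assumes "coeff_matrix G 0 = mat 1"
  obtains H where "H ** G = mat 1" "G ** H = mat 1" "coeff_matrix H 0 = mat 1"
proof -
  obtain H where H: "H ** G = mat 1" "coeff_matrix H 0 = mat 1"
    using left_inverse_coeff_matrix[OF assms] .
  obtain G' where G': "G' ** H = mat 1"
    using left_inverse_coeff_matrix[OF H(2)] .
  have "G' = G' ** (H ** G)" by (simp add: H(1))
  also have "\<dots> = G" by (simp add: matrix_mul_assoc G')
  finally show ?thesis using that H G' by simp
qed

section \<open>Lifting the standard basis to power series\<close>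

lemma vec_coeff_simps [simp]:
  "vec_coeff (x + y) k = vec_coeff x k + vec_coeff y k"
  "vec_coeff (x - y) k = vec_coeff x k - vec_coeff y k"
  "vec_coeff (- x) k = - vec_coeff x k"
  "vec_coeff 0 k = 0"
  "vec_coeff (c *s x) 0 = fps_nth c 0 *s vec_coeff x 0"
  by (simp_all add: vec_coeff_def vec_eq_iff)

lemma vec_coeff_axis: "vec_coeff (axis i 1) 0 = axis i 1"
  by (simp add: vec_coeff_def axis_def vec_eq_iff)

definition frame_matrix :: "('n \<Rightarrow> 'a ^ 'm) \<Rightarrow> 'a ^ 'n ^ 'm" where
  "frame_matrix f = (\<chi> i j. f j $ i)"

lemma frame_matrix_mult_vec:
  fixes f :: "'n::finite \<Rightarrow> 'a::comm_semiring_1 ^ 'm"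
  shows "frame_matrix f *v x = (\<Sum>i\<in>UNIV. x $ i *s f i)"
  by (simp add: frame_matrix_def matrix_vector_mult_def vec_eq_iff mult.commute)

lemma inverse_frame_matrix:
  fixes f :: "'n \<Rightarrow> complex fps ^ 'n"
  assumes "\<And>i. vec_coeff (f i) 0 = axis i 1"
  obtains H where "H ** frame_matrix f = mat 1" "frame_matrix f ** H = mat 1" "coeff_matrix H 0 = mat 1"
proof (rule inverse_coeff_matrix)
  have "fps_nth (f j $ i) 0 = (if i = j then 1 else 0)" for i j
    using assms[of j] by (auto simp: vec_coeff_def vec_eq_iff axis_def)
  then show "coeff_matrix (frame_matrix f) 0 = mat 1"
    by (simp add: coeff_matrix_def frame_matrix_def mat_def vec_eq_iff)
qed

text \<open>A family that reduces to the standard basis modulo \<open>t\<close> is a basis, because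
  its matrix of columns has constant term the identity and is therefore invertible.\<close>

lemma
  fixes f :: "'n \<Rightarrow> complex fps ^ 'n"
  assumes "\<And>i. vec_coeff (f i) 0 = axis i 1"
  shows lifted_frame_spans: "\<exists>x. v = (\<Sum>i\<in>UNIV. x $ i *s f i)"
    and lifted_frame_independent: "(\<Sum>i\<in>UNIV. x $ i *s f i) = 0 \<Longrightarrow> x = 0"
proof -
  obtain H where H: "H ** frame_matrix f = mat 1" "frame_matrix f ** H = mat 1"
    using inverse_frame_matrix[OF assms] .
  have "v = frame_matrix f *v (H *v v)"
    by (simp add: matrix_vector_mul_assoc H)
  then show "\<exists>x. v = (\<Sum>i\<in>UNIV. x $ i *s f i)"
    unfolding frame_matrix_mult_vec by blast
  assume "(\<Sum>i\<in>UNIV. x $ i *s f i) = 0"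
  then have "H *v (frame_matrix f *v x) = 0"
    by (simp add: frame_matrix_mult_vec)
  then show "x = 0"
    by (simp add: matrix_vector_mul_assoc H)
qed

section \<open>Consequences of the Leibniz identity and an invariant form\<close>

text \<open>The form has values in a ring that is not a field, and nondegeneracy only excludes
  nonzero vectors orthogonal to everything. Hence determinants of \<open>B\<close> are proved
  nonzero below, not invertible.\<close>

locale W3_star_lift =
  fixes \<mu> :: "complex fps ^ 5 \<Rightarrow> complex fps ^ 5 \<Rightarrow> complex fps ^ 5"
    and B :: "complex fps ^ 5 \<Rightarrow> complex fps ^ 5 \<Rightarrow> complex fps"
  assumes leibniz: "leibniz_algebra \<mu>"
    and reduction: "vec_coeff (\<mu> x y) 0 = W3_star (vec_coeff x 0) (vec_coeff y 0)"
    and bilinear: "bilinear_form B"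
    and symmetric: "B x y = B y x"
    and nondegenerate: "(\<And>y. B x y = 0) \<Longrightarrow> x = 0"
    and invariant: "B (\<mu> x y) z = B x (\<mu> y z)"
begin

lemma module_hom_\<mu>: "module_hom (*s) (*s) (\<lambda>y. \<mu> x y)" "module_hom (*s) (*s) (\<lambda>x. \<mu> x y)"
  using leibniz by (auto simp: leibniz_algebra_def bilinear_bracket_def)

lemma module_hom_B: "module_hom (*s) (*) (\<lambda>y. B x y)" "module_hom (*s) (*) (\<lambda>x. B x y)"
  using bilinear by (auto simp: bilinear_form_def)

lemmas \<mu>_simps =
  module_hom_\<mu>[THEN module_hom.add] module_hom_\<mu>[THEN module_hom.scale]
  module_hom_\<mu>[THEN module_hom.zero] module_hom_\<mu>[THEN module_hom.neg]
  module_hom_\<mu>[THEN module_hom.diff]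

lemmas B_simps =
  module_hom_B[THEN module_hom.add] module_hom_B[THEN module_hom.scale]
  module_hom_B[THEN module_hom.zero] module_hom_B[THEN module_hom.neg]
  module_hom_B[THEN module_hom.diff]

lemma cyclic: "B (\<mu> x y) z = B (\<mu> y z) x"
  by (metis invariant symmetric)

definition central :: "complex fps ^ 5 \<Rightarrow> bool" where
  "central s \<longleftrightarrow> (\<forall>x. \<mu> s x = 0 \<and> \<mu> x s = 0)"

lemma central_mult: "central s \<Longrightarrow> \<mu> s x = 0" "central s \<Longrightarrow> \<mu> x s = 0"
  by (simp_all add: central_def)

lemma central_scale: "central s \<Longrightarrow> central (c *s s)"
  by (simp add: central_def \<mu>_simps)

lemma central_orthogonal:
  assumes "central s"
  shows "B s (\<mu> x y) = 0" "B (\<mu> x y) s = 0"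
proof -
  show "B s (\<mu> x y) = 0"
    using assms by (simp add: invariant [symmetric] central_mult B_simps)
  then show "B (\<mu> x y) s = 0"
    by (subst symmetric)
qed

text \<open>Adding the Leibniz identities for \<open>x, y\<close> and for \<open>y, x\<close> shows
  that \<open>s\<close> annihilates from one side. Cyclicity of the form and nondegeneracy carry
  this over to the other side.\<close>

lemma central_symmetrization: "central (\<mu> x y + \<mu> y x)"
proof -
  define s where "s = \<mu> x y + \<mu> y x"
  consider "left_leibniz \<mu>" | "right_leibniz \<mu>"
    using leibniz by (auto simp: leibniz_algebra_def)
  then have "central s"
  proof cases
    case 1
    have left: "\<mu> s z = 0" for z
    proof -
      have "\<mu> x (\<mu> y z) = \<mu> (\<mu> x y) z + \<mu> y (\<mu> x z)" "\<mu> y (\<mu> x z) = \<mu> (\<mu> y x) z + \<mu> x (\<mu> y z)"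
        using 1 unfolding left_leibniz_def by blast+
      then show ?thesis by (simp add: s_def \<mu>_simps)
    qed
    have "\<mu> z s = 0" for z
    proof (rule nondegenerate)
      fix w
      have "B (\<mu> z s) w = B (\<mu> s w) z" by (rule cyclic)
      then show "B (\<mu> z s) w = 0" by (simp add: left B_simps)
    qed
    with left show ?thesis by (simp add: central_def)
  next
    case 2
    have right: "\<mu> z s = 0" for z
    proof -
      have "\<mu> z (\<mu> x y) = \<mu> (\<mu> z x) y - \<mu> (\<mu> z y) x" "\<mu> z (\<mu> y x) = \<mu> (\<mu> z y) x - \<mu> (\<mu> z x) y"
        using 2 unfolding right_leibniz_def by blast+
      then show ?thesis by (simp add: s_def \<mu>_simps)
    qed
    have "\<mu> s z = 0" for z
    proof (rule nondegenerate)
      fix w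
      have "B (\<mu> s z) w = B (\<mu> w s) z" by (metis cyclic)
      then show "B (\<mu> s z) w = 0" by (simp add: right B_simps)
    qed
    with right show ?thesis by (simp add: central_def)
  qed
  then show ?thesis by (simp add: s_def)
qed

lemma central_square: "central (\<mu> x x)"
proof -
  have "\<mu> x x = fps_const (1/2) *s (\<mu> x x + \<mu> x x)"
    by (simp add: vec_eq_iff fps_eq_iff)
  then show ?thesis by (metis central_scale central_symmetrization)
qed

text \<open>Pairing the sum of both sides with \<open>w\<close> moves the symmetrization onto
  \<open>w\<close> and \<open>x\<close>. That is central, hence orthogonal to the product
  \<open>\<mu> y z\<close>.\<close>

lemma mult_product_anticommute: "\<mu> x (\<mu> y z) = - \<mu> (\<mu> y z) x"
proof -
  have "\<mu> x (\<mu> y z) + \<mu> (\<mu> y z) x = 0"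
  proof (rule nondegenerate)
    fix w
    have "B (\<mu> x (\<mu> y z)) w = B (\<mu> y z) (\<mu> w x)" "B (\<mu> (\<mu> y z) x) w = B (\<mu> y z) (\<mu> x w)"
      by (metis cyclic symmetric) (rule invariant)
    then have "B (\<mu> x (\<mu> y z) + \<mu> (\<mu> y z) x) w = B (\<mu> y z) (\<mu> w x + \<mu> x w)"
      by (simp add: B_simps)
    also have "\<dots> = 0"
      by (rule central_orthogonal central_symmetrization)+
    finally show "B (\<mu> x (\<mu> y z) + \<mu> (\<mu> y z) x) w = 0" .
  qed
  then show ?thesis by (simp add: eq_neg_iff_add_eq_0)
qed

end

section \<open>Bases generated by lifts of \<open>e 4\<close> and \<open>e 5\<close>\<close>

locale W3_star_generators = W3_star_lift +
  fixes a b :: "complex fps ^ 5"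
  assumes lift_a: "vec_coeff a 0 = e 4" and lift_b: "vec_coeff b 0 = e 5"
begin

abbreviation "f1 \<equiv> \<mu> a a"
abbreviation "f2 \<equiv> \<mu> b b"
text \<open>The antisymmetric part is taken because \<open>a\<close> and \<open>b\<close> need not
  anticommute yet; once they do, this is \<open>\<mu> a b\<close>.\<close>

definition f3 where "f3 = fps_const (1/2) *s (\<mu> a b - \<mu> b a)"

definition frame :: "5 \<Rightarrow> complex fps ^ 5" where
  "frame i = (if i = 1 then f1 else if i = 2 then f2 else if i = 3 then f3 else if i = 4 then a else b)"

lemma lift_f3: "vec_coeff f3 0 = e 3"
  by (simp add: f3_def reduction lift_a lift_b W3_star_table vec_eq_iff)

lemma lift_frame: "vec_coeff (frame i) 0 = axis i 1"
  using exhaust_5[of i]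
  by (elim disjE; simp add: frame_def lift_f3 lift_a lift_b reduction W3_star_table)

lemma spans: "\<exists>x1 x2 x3 x4 x5. v = x1 *s f1 + x2 *s f2 + x3 *s f3 + x4 *s a + x5 *s b"
proof -
  obtain x where "v = (\<Sum>i\<in>UNIV. x $ i *s frame i)"
    using lifted_frame_spans[OF lift_frame] by blast
  then have "v = x $ 1 *s f1 + x $ 2 *s f2 + x $ 3 *s f3 + x $ 4 *s a + x $ 5 *s b"
    by (simp add: sum_5 frame_def)
  then show ?thesis by blast
qed

lemma independent:
  assumes "x1 *s f1 + x2 *s f2 + x3 *s f3 + x4 *s a + x5 *s b = 0"
  shows "x1 = 0" "x2 = 0" "x3 = 0" "x4 = 0" "x5 = 0"
proof -
  define x :: "complex fps ^ 5" where
    "x = (\<chi> i. if i = 1 then x1 else if i = 2 then x2 else if i = 3 then x3 else if i = 4 then x4 else x5)"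
  have x: "x $ 1 = x1" "x $ 2 = x2" "x $ 3 = x3" "x $ 4 = x4" "x $ 5 = x5"
    by (simp_all add: x_def)
  have "(\<Sum>i\<in>UNIV. x $ i *s frame i) = 0"
    unfolding sum_5 x using assms by (simp add: frame_def)
  then have "x = 0" by (rule lifted_frame_independent[OF lift_frame])
  with x show "x1 = 0" "x2 = 0" "x3 = 0" "x4 = 0" "x5 = 0" by simp_all
qed

lemma central_f1: "central f1" and central_f2: "central f2"
  by (rule central_square)+

lemma orthogonal:
  assumes "central s"
  shows "B s f1 = 0" "B s f2 = 0" "B s f3 = 0" "B f1 s = 0" "B f2 s = 0" "B f3 s = 0"
  using assms by (simp_all add: f3_def B_simps central_orthogonal)

text \<open>Central elements are orthogonal to products, so a combination of \<open>f1\<close> and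
  \<open>f2\<close> is detected by its pairings with \<open>a\<close> and \<open>b\<close> alone;
  the 2 by 2 pairing matrix must then have trivial kernel.\<close>

lemma det_nonzero: "B f1 a * B f2 b - B f1 b * B f2 a \<noteq> 0"
proof
  assume det: "B f1 a * B f2 b - B f1 b * B f2 a = 0"
  note orth = orthogonal[OF central_f1] orthogonal[OF central_f2]
  have zero: "x1 = 0 \<and> x2 = 0"
    if "x1 * B f1 a + x2 * B f2 a = 0" "x1 * B f1 b + x2 * B f2 b = 0" for x1 x2
  proof -
    have "x1 *s f1 + x2 *s f2 = 0"
    proof (rule nondegenerate)
      fix y
      obtain y1 y2 y3 y4 y5 where y: "y = y1 *s f1 + y2 *s f2 + y3 *s f3 + y4 *s a + y5 *s b"
        using spans by blast
      have "B (x1 *s f1 + x2 *s f2) y =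
          y4 * (x1 * B f1 a + x2 * B f2 a) + y5 * (x1 * B f1 b + x2 * B f2 b)"
        unfolding y by (simp add: B_simps orth algebra_simps)
      then show "B (x1 *s f1 + x2 *s f2) y = 0" by (simp add: that)
    qed
    then show ?thesis
      using independent[of x1 x2 0 0 0] by simp
  qed
  \<comment> \<open>With zero determinant, the rows of the adjugate lie in the kernel. So all four
    entries vanish, and then \<open>(1, 0)\<close> lies in the kernel as well.\<close>
  have "B f2 a = 0 \<and> - B f1 a = 0"
    by (rule zero) (use det in \<open>simp_all add: algebra_simps\<close>)
  moreover have "B f2 b = 0 \<and> - B f1 b = 0"
    by (rule zero) (use det in \<open>simp_all add: algebra_simps\<close>)
  ultimately have "(1 :: complex fps) = 0 \<and> (0 :: complex fps) = 0"
    by (intro zero) simp_all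
  then show False by simp
qed

text \<open>If \<open>f3\<close> were isotropic, it could be corrected by \<open>f1\<close> and
  \<open>f2\<close>, after scaling by the determinant \<open>d\<close>, to a vector orthogonal to
  the whole basis.\<close>

lemma norm_f3_nonzero: "B f3 f3 \<noteq> 0"
proof
  assume f3: "B f3 f3 = 0"
  note orth = orthogonal[OF central_f1] orthogonal[OF central_f2]
  define d where "d = B f1 a * B f2 b - B f1 b * B f2 a"
  \<comment> \<open>Cramer's rule without division: \<open>x1\<close> and \<open>x2\<close> make the
    combination below orthogonal to \<open>a\<close> and \<open>b\<close>.\<close>
  define x1 where "x1 = B f3 b * B f2 a - B f3 a * B f2 b"
  define x2 where "x2 = B f3 a * B f1 b - B f3 b * B f1 a"
  have "x1 *s f1 + x2 *s f2 + d *s f3 = 0"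
  proof (rule nondegenerate)
    fix y
    obtain y1 y2 y3 y4 y5 where y: "y = y1 *s f1 + y2 *s f2 + y3 *s f3 + y4 *s a + y5 *s b"
      using spans by blast
    have "B (x1 *s f1 + x2 *s f2 + d *s f3) y =
        y4 * (x1 * B f1 a + x2 * B f2 a + d * B f3 a) + y5 * (x1 * B f1 b + x2 * B f2 b + d * B f3 b)"
      unfolding y by (simp add: B_simps orth f3 algebra_simps)
    also have "\<dots> = 0"
      by (simp add: x1_def x2_def d_def algebra_simps)
    finally show "B (x1 *s f1 + x2 *s f2 + d *s f3) y = 0" .
  qed
  then have "d = 0"
    using independent(3)[of x1 x2 d 0 0] by simp
  then show False using det_nonzero by (simp add: d_def)
qed

text \<open>Orthogonality to \<open>f1\<close> and \<open>f2\<close> removes the coefficients of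
  \<open>a\<close> and \<open>b\<close> by \<open>det_nonzero\<close>; orthogonality to
  \<open>f3\<close> then removes that of \<open>f3\<close>.\<close>

lemma orthogonal_complement:
  assumes "B w f1 = 0" "B w f2 = 0" "B w f3 = 0"
  shows "\<exists>p q. w = p *s f1 + q *s f2"
proof -
  note orth = orthogonal[OF central_f1] orthogonal[OF central_f2]
  obtain p q r x y where w: "w = p *s f1 + q *s f2 + r *s f3 + x *s a + y *s b"
    using spans by blast
  define d where "d = B f1 a * B f2 b - B f1 b * B f2 a"
  have "x * B f1 a + y * B f1 b = 0" "x * B f2 a + y * B f2 b = 0"
    using assms(1,2) unfolding w by (simp_all add: B_simps orth symmetric)
  then have "x * d = 0" "y * d = 0"
    unfolding d_def by algebra+
  then have "x = 0" "y = 0"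
    using det_nonzero by (auto simp: d_def)
  with assms(3) have "r * B f3 f3 = 0"
    unfolding w by (simp add: B_simps orth)
  with \<open>x = 0\<close> \<open>y = 0\<close> show ?thesis
    using norm_f3_nonzero by (auto simp: w)
qed

text \<open>The constant terms vanish because \<open>e 4\<close> and \<open>e 5\<close> anticommute
  in \<open>W3_star\<close>. The factors 2 simplify the later quadratic equation.\<close>

lemma symmetrized_product:
  obtains p q where "\<mu> a b + \<mu> b a = (2 * p) *s f1 + (2 * q) *s f2" "fps_nth p 0 = 0" "fps_nth q 0 = 0"
proof -
  have "central (\<mu> a b + \<mu> b a)" by (rule central_symmetrization)
  then obtain p q where pq: "\<mu> a b + \<mu> b a = p *s f1 + q *s f2"
    using orthogonal_complement orthogonal by metis
  have "vec_coeff (\<mu> a b + \<mu> b a) 0 = 0"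
    by (simp add: reduction lift_a lift_b W3_star_table)
  then have "fps_nth p 0 *s e 1 + fps_nth q 0 *s e 2 = 0"
    unfolding pq by (simp add: reduction lift_a lift_b W3_star_table)
  then have "(fps_nth p 0 *s e 1 + fps_nth q 0 *s e 2) $ 1 = 0"
    "(fps_nth p 0 *s e 1 + fps_nth q 0 *s e 2) $ 2 = 0"
    by simp_all
  then have "fps_nth p 0 = 0" "fps_nth q 0 = 0"
    by (simp_all add: axis_def)
  moreover have half: "2 * (fps_const (1/2) * z) = z" for z :: "complex fps"
    by (simp add: fps_eq_iff numeral_fps_const mult.assoc)
  ultimately show ?thesis
    by (intro that[of "fps_const (1/2) * p" "fps_const (1/2) * q"]) (simp_all only: half pq fps_mult_nth_0 mult_zero_right)
qed

lemma structure_constants: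
  assumes anti: "\<mu> b a = - \<mu> a b"
  obtains \<beta> \<gamma> where "\<mu> (\<mu> a b) a = \<beta> *s f2" "\<mu> (\<mu> a b) b = \<gamma> *s f1"
    "fps_nth \<beta> 0 = 1" "fps_nth \<gamma> 0 = 1"
proof -
  have f3: "f3 = \<mu> a b"
    by (simp add: f3_def anti vec_eq_iff fps_eq_iff)
  have two: "z = 0" if "z = - z" for z :: "complex fps"
    using that by simp
  \<comment> \<open>Cyclicity gives two expressions for the same value that are opposite by
    \<open>anti\<close>; the same happens for \<open>B f2 a\<close>. The pairing matrix becomes
    diagonal.\<close>
  have "B f1 b = B (\<mu> a b) a" "B f1 b = B (\<mu> b a) a"
    by (metis cyclic)+
  then have f1b: "B f1 b = 0" by (auto simp: anti B_simps intro: two)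
  have "B f2 a = B (\<mu> a b) b" "B f2 a = B (\<mu> b a) b"
    by (metis cyclic)+
  then have f2a: "B f2 a = 0" by (auto simp: anti B_simps intro: two)
  have nz: "B f1 a \<noteq> 0" "B f2 b \<noteq> 0"
    using det_nonzero by (auto simp: f1b)
  have sq: "\<mu> f3 f3 = 0"
  proof -
    have "\<mu> f3 f3 = - \<mu> f3 f3"
      unfolding f3 by (rule mult_product_anticommute)
    then show ?thesis by (simp add: vec_eq_iff)
  qed
  have span: "\<exists>p q. \<mu> f3 x = p *s f1 + q *s f2" for x
  proof (rule orthogonal_complement)
    show "B (\<mu> f3 x) f1 = 0" "B (\<mu> f3 x) f2 = 0"
      by (simp_all add: central_orthogonal central_square)
    have "B (\<mu> f3 x) f3 = B (\<mu> f3 f3) x"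
      by (metis cyclic)
    then show "B (\<mu> f3 x) f3 = 0" by (simp add: sq B_simps)
  qed
  obtain p \<beta> where \<beta>: "\<mu> f3 a = p *s f1 + \<beta> *s f2"
    using span by blast
  \<comment> \<open>Pairing with \<open>a\<close> isolates the coefficient of \<open>f1\<close>; by
    invariance the value is \<open>B f3 f1\<close>, which is zero.\<close>
  have "p * B f1 a = B (\<mu> f3 a) a"
    by (simp add: \<beta> B_simps f2a)
  also have "\<dots> = 0"
    by (simp add: invariant orthogonal central_square)
  finally have "p = 0" using nz by simp
  obtain \<gamma> q where \<gamma>: "\<mu> f3 b = \<gamma> *s f1 + q *s f2"
    using span by blast
  have "q * B f2 b = B (\<mu> f3 b) b"
    by (simp add: \<gamma> B_simps f1b)
  also have "\<dots> = 0"
    by (simp add: invariant orthogonal central_square)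
  finally have "q = 0" using nz by simp
  have "vec_coeff (\<mu> f3 a) 0 = e 2" "vec_coeff (\<mu> f3 b) 0 = e 1"
    by (simp_all add: reduction lift_a lift_b lift_f3 W3_star_table)
  then have "fps_nth \<beta> 0 *s e 2 = e 2" "fps_nth \<gamma> 0 *s e 1 = e 1"
    by (simp_all add: \<beta> \<gamma> \<open>p = 0\<close> \<open>q = 0\<close> reduction lift_a lift_b W3_star_table)
  then have "(fps_nth \<beta> 0 *s e 2) $ 2 = e 2 $ 2" "(fps_nth \<gamma> 0 *s e 1) $ 1 = e 1 $ 1"
    by simp_all
  then show ?thesis
    using that \<beta> \<gamma> \<open>p = 0\<close> \<open>q = 0\<close> by (simp add: f3 axis_def)
qed

end

section \<open>Normalising the generators\<close>

context W3_star_lift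
begin

lemma anticommuting_generators:
  obtains a b where "W3_star_generators \<mu> B a b" "\<mu> b a = - \<mu> a b"
proof -
  interpret W3_star_generators \<mu> B "axis 4 1" "axis 5 1"
    by unfold_locales (rule vec_coeff_axis)+
  let ?a = "axis 4 1 :: complex fps ^ 5" and ?b = "axis 5 1 :: complex fps ^ 5"
  obtain p q where pq: "\<mu> ?a ?b + \<mu> ?b ?a = (2 * p) *s f1 + (2 * q) *s f2" "fps_nth p 0 = 0" "fps_nth q 0 = 0"
    by (rule symmetrized_product)
  \<comment> \<open>\<open>s\<close> is the square root of the discriminant of the equation for
    \<open>w\<close>. Writing the root as \<open>2 / (1 + s)\<close> avoids dividing by
    \<open>p * q\<close>, which is not invertible.\<close>
  obtain s where s: "s ^ 2 = 1 - 4 * (p * q)" "fps_nth s 0 = 1"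
    using fps_root_exists[of "1 - 4 * (p * q)" 2] pq by auto
  define r where "r = inverse (1 + s)"
  have r: "r * (1 + s) = 1"
    unfolding r_def using s(2) by (intro inverse_mult_eq_1) simp
  define w where "w = 2 * r"
  \<comment> \<open>\<open>w\<close> is the root of \<open>w = 1 + p q w\<^sup>2\<close> with constant term \<open>1\<close>.\<close>
  have "w = 1 + w * w * (p * q)"
  proof -
    have "(1 + s)\<^sup>2 * (1 + w * w * (p * q) - w) = 0"
    proof -
      have "(1 + s)\<^sup>2 * (1 + w * w * (p * q) - w) =
          (1 + s)\<^sup>2 + (r * (1 + s))\<^sup>2 * (4 * (p * q)) - 2 * (1 + s) * (r * (1 + s))"
        unfolding w_def by algebra
      also have "\<dots> = 0"
        unfolding r using s(1) by (simp add: power2_eq_square algebra_simps)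
      finally show ?thesis .
    qed
    moreover have "(1 + s)\<^sup>2 \<noteq> 0"
      using r by auto
    ultimately show ?thesis by simp
  qed
  \<comment> \<open>The new elements still lift \<open>e 4\<close> and \<open>e 5\<close>, since
    \<open>p\<close> and \<open>q\<close> have no constant term. The equation for \<open>w\<close>
    is what cancels the symmetrized product.\<close>
  define a b where "a = ?a - (w * q) *s ?b" and "b = ?b - (w * p) *s ?a"
  have lift: "W3_star_generators \<mu> B a b"
    by unfold_locales (simp_all add: a_def b_def lift_a lift_b pq)
  have "\<mu> a b + \<mu> b a = (1 + w * w * (p * q)) *s (\<mu> ?a ?b + \<mu> ?b ?a)
      - (2 * w * p) *s f1 - (2 * w * q) *s f2"
    unfolding a_def b_def by (simp add: \<mu>_simps vec_eq_iff algebra_simps)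
  also have "\<dots> = 0"
    unfolding pq(1) \<open>w = 1 + w * w * (p * q)\<close> [symmetric] by (simp add: vec_eq_iff algebra_simps)
  finally have "\<mu> b a = - \<mu> a b"
    by (simp add: eq_neg_iff_add_eq_0 add.commute)
  with lift show ?thesis by (rule that)
qed

lemma W3_star_table_frame:
  obtains f where "\<And>i. vec_coeff (f i) 0 = axis i 1"
    "\<And>i j. \<mu> (f i) (f j) =
       (if (i, j) = (3, 4) then f 2 else if (i, j) = (4, 3) then - f 2
        else if (i, j) = (3, 5) then f 1 else if (i, j) = (5, 3) then - f 1
        else if (i, j) = (4, 5) then f 3 else if (i, j) = (5, 4) then - f 3
        else if (i, j) = (5, 5) then f 2 else if (i, j) = (4, 4) then f 1 else 0)"
proof -
  obtain a b where "W3_star_generators \<mu> B a b" and anti: "\<mu> b a = - \<mu> a b"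
    by (rule anticommuting_generators)
  then interpret ab: W3_star_generators \<mu> B a b by simp
  obtain \<beta> \<gamma> where \<beta>\<gamma>: "\<mu> (\<mu> a b) a = \<beta> *s \<mu> b b" "\<mu> (\<mu> a b) b = \<gamma> *s \<mu> a a"
    and nth: "fps_nth \<beta> 0 = 1" "fps_nth \<gamma> 0 = 1"
    using ab.structure_constants[OF anti] .
  \<comment> \<open>After rescaling, \<open>\<mu> f3 a = f2\<close> demands
    \<open>y = x\<^sup>2 * \<beta>\<close> and \<open>\<mu> f3 b = f1\<close> demands
    \<open>y\<^sup>2 * \<gamma> = x\<close>. Eliminating \<open>y\<close> leaves this cube
    root.\<close>
  obtain x where x: "x ^ 3 = inverse (\<beta>\<^sup>2 * \<gamma>)" "fps_nth x 0 = 1"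
    using fps_root_exists[of "inverse (\<beta>\<^sup>2 * \<gamma>)" 3] nth by (auto simp: power2_eq_square)
  define y where "y = x\<^sup>2 * \<beta>"
  have "x ^ 3 * (\<beta>\<^sup>2 * \<gamma>) = 1"
    unfolding x(1) by (rule inverse_mult_eq_1) (simp add: nth power2_eq_square)
  then have "y\<^sup>2 * \<gamma> = x"
    unfolding y_def by algebra
  interpret W3_star_generators \<mu> B "x *s a" "y *s b"
    by unfold_locales (simp_all add: ab.lift_a ab.lift_b x nth y_def power2_eq_square)
  have f: "frame 1 = (x * x) *s \<mu> a a" "frame 2 = (y * y) *s \<mu> b b" "frame 3 = (x * y) *s \<mu> a b"
    "frame 4 = x *s a" "frame 5 = y *s b"
    by (simp_all add: frame_def f3_def \<mu>_simps anti vec_eq_iff fps_eq_iff mult.commute)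
  have c: "central (frame 1)" "central (frame 2)"
    by (simp_all add: frame_def central_square)
  have m34: "\<mu> (frame 3) (frame 4) = frame 2"
    by (simp add: f \<mu>_simps \<beta>\<gamma>) (simp add: y_def power2_eq_square mult.assoc mult.left_commute mult.commute)
  have "\<mu> (frame 3) (frame 5) = (x * (y\<^sup>2 * \<gamma>)) *s \<mu> a a"
    by (simp add: f \<mu>_simps \<beta>\<gamma> power2_eq_square mult.assoc mult.left_commute)
  then have m35: "\<mu> (frame 3) (frame 5) = frame 1"
    by (simp only: \<open>y\<^sup>2 * \<gamma> = x\<close> f)
  have m43: "\<mu> (frame 4) (frame 3) = - frame 2" and m53: "\<mu> (frame 5) (frame 3) = - frame 1"
    unfolding m34 [symmetric] m35 [symmetric] f by (simp_all add: \<mu>_simps mult_product_anticommute[of _ a b] mult.commute)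
  have m33: "\<mu> (frame 3) (frame 3) = 0"
  proof -
    have "\<mu> (\<mu> a b) (\<mu> a b) = - \<mu> (\<mu> a b) (\<mu> a b)"
      by (rule mult_product_anticommute)
    then have "\<mu> (\<mu> a b) (\<mu> a b) = 0" by (simp add: vec_eq_iff)
    then show ?thesis by (simp add: f \<mu>_simps)
  qed
  have m: "\<mu> (frame 4) (frame 4) = frame 1" "\<mu> (frame 5) (frame 5) = frame 2"
    "\<mu> (frame 4) (frame 5) = frame 3" "\<mu> (frame 5) (frame 4) = - frame 3"
    by (simp_all add: f \<mu>_simps anti mult.commute)
  have "\<mu> (frame i) (frame j) =
       (if (i, j) = (3, 4) then frame 2 else if (i, j) = (4, 3) then - frame 2
        else if (i, j) = (3, 5) then frame 1 else if (i, j) = (5, 3) then - frame 1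
        else if (i, j) = (4, 5) then frame 3 else if (i, j) = (5, 4) then - frame 3
        else if (i, j) = (5, 5) then frame 2 else if (i, j) = (4, 4) then frame 1 else 0)" for i j
    using exhaust_5[of i] exhaust_5[of j]
    by (elim disjE; simp add: m m33 m34 m35 m43 m53 central_mult[OF c(1)] central_mult[OF c(2)])
  with lift_frame show ?thesis by (rule that)
qed

end

section \<open>Passing between deformations and the lifted setting\<close>

text \<open>Only \<open>k = 0\<close> contributes, and the remaining convolution is the product of
  power series, so the formulas of \<open>W3_star\<close> persist.\<close>

lemma constant_deformation_W3_star:
  fixes x y :: "complex fps ^ 5"
  defines "z \<equiv> bracket_series (constant_deformation W3_star) x y"
  shows "z $ 1 = x $ 3 * y $ 5 - x $ 5 * y $ 3 + x $ 4 * y $ 4"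
    "z $ 2 = x $ 3 * y $ 4 - x $ 4 * y $ 3 + x $ 5 * y $ 5"
    "z $ 3 = x $ 4 * y $ 5 - x $ 5 * y $ 4"
    "z $ 4 = 0" "z $ 5 = 0"
proof -
  have "(\<Sum>k\<le>m. \<Sum>i\<le>m - k. constant_deformation W3_star k (vec_coeff x i) (vec_coeff y (m - k - i))) =
      (\<Sum>i\<le>m. W3_star (vec_coeff x i) (vec_coeff y (m - i)))" for m
    by (subst sum.remove[of _ 0]) (simp_all add: constant_deformation_def)
  then have "fps_nth (z $ i) m = (\<Sum>l\<le>m. W3_star (vec_coeff x l) (vec_coeff y (m - l)) $ i)" for i m
    by (simp add: z_def bracket_series_def vec_series_def)
  then show "z $ 1 = x $ 3 * y $ 5 - x $ 5 * y $ 3 + x $ 4 * y $ 4"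
    "z $ 2 = x $ 3 * y $ 4 - x $ 4 * y $ 3 + x $ 5 * y $ 5"
    "z $ 3 = x $ 4 * y $ 5 - x $ 5 * y $ 4"
    "z $ 4 = 0" "z $ 5 = 0"
    by (simp_all add: fps_eq_iff W3_star_nth vec_coeff_def fps_mult_nth atLeast0AtMost
      sum.distrib sum_subtractf)
qed

lemma bracket_series_coeff_0: "vec_coeff (bracket_series \<phi> x y) 0 = \<phi> 0 (vec_coeff x 0) (vec_coeff y 0)"
  by (simp add: bracket_series_def vec_coeff_def vec_series_def vec_eq_iff)

text \<open>Lets a matrix over power series serve as the formal family of linear maps in an
  equivalence.\<close>

lemma linear_series_matrix:
  fixes H :: "complex fps ^ 'n ^ 'n"
  shows "linear_series (\<lambda>k x. coeff_matrix H k *v x) = (\<lambda>x. H *v x)"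
proof -
  have "fps_nth (\<Sum>j\<in>UNIV. H $ i $ j * x $ j) m =
      (\<Sum>k\<le>m. \<Sum>j\<in>UNIV. fps_nth (H $ i $ j) k * fps_nth (x $ j) (m - k))" for i m x
    by (simp add: fps_sum_nth fps_mult_nth atLeast0AtMost) (rule sum.swap)
  then show ?thesis
    by (simp add: linear_series_def vec_series_def vec_coeff_def coeff_matrix_def
      matrix_vector_mult_def fun_eq_iff vec_eq_iff fps_eq_iff)
qed

text \<open>A power of the variable clears the poles of the Gram matrix. Scaling by it preserves
  symmetry, invariance and nondegeneracy.\<close>

lemma laurent_form_lattice:
  fixes \<mu> :: "complex fps ^ 'n \<Rightarrow> complex fps ^ 'n \<Rightarrow> complex fps ^ 'n"
  assumes "bilinear_bracket \<mu>" and "metric_leibniz_algebra (laurent_extension \<mu>)"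
  obtains B where "bilinear_form B" "symmetric_form B" "nondegenerate_form B" "invariant_form \<mu> B"
proof -
  obtain B' where B': "bilinear_form B'" "symmetric_form B'" "nondegenerate_form B'"
    "invariant_form (laurent_extension \<mu>) B'"
    using assms(2) by (auto simp: metric_leibniz_algebra_def)
  have hom_\<mu>: "module_hom (*s) (*s) (\<lambda>y. \<mu> x y)" "module_hom (*s) (*s) (\<lambda>x. \<mu> x y)" for x y
    using assms(1) by (auto simp: bilinear_bracket_def)
  have hom_B': "module_hom (*s) (*) (\<lambda>y. B' x y)" "module_hom (*s) (*) (\<lambda>x. B' x y)" for x y
    using B'(1) by (auto simp: bilinear_form_def)
  define b where "b i j = B' (axis i 1) (axis j 1)" for i j
  have B'_sum: "B' x y = (\<Sum>i\<in>UNIV. \<Sum>j\<in>UNIV. x $ i * y $ j * b i j)" for x y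
  proof -
    have "B' x y = B' (\<Sum>i\<in>UNIV. x $ i *s axis i 1) (\<Sum>j\<in>UNIV. y $ j *s axis j 1)"
      by (simp only: basis_expansion)
    also have "\<dots> = (\<Sum>i\<in>UNIV. \<Sum>j\<in>UNIV. x $ i * y $ j * b i j)"
      unfolding hom_B'[THEN module_hom.sum] hom_B'[THEN module_hom.scale] b_def
      by (subst sum.swap) (simp add: sum_distrib_left ac_simps)
    finally show ?thesis .
  qed
  \<comment> \<open>The sum of all pole orders bounds each single one; \<open>nat\<close> turns
    entries without a pole into 0.\<close>
  define N where "N = (\<Sum>i\<in>UNIV. \<Sum>j\<in>UNIV. nat (- fls_subdegree (b i j)))"
  define g where "g i j = fls_regpart (fls_X ^ N * b i j)" for i j
  have g: "fps_to_fls (g i j) = fls_X ^ N * b i j" for i j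
  proof -
    have "nat (- fls_subdegree (b i j)) \<le> (\<Sum>j\<in>UNIV. nat (- fls_subdegree (b i j)))"
      by (rule member_le_sum) simp_all
    also have "\<dots> \<le> N"
      unfolding N_def by (rule member_le_sum) simp_all
    finally have "0 \<le> fls_subdegree (fls_X ^ N * b i j)"
      by (cases "b i j = 0") (simp_all add: fls_subdegree_pow)
    then show ?thesis
      unfolding g_def by (rule fls_regpart_to_fls_trivial)
  qed
  define \<iota> where "\<iota> x = (\<chi> i. fps_to_fls (x $ i))" for x :: "complex fps ^ 'n"
  define B where "B x y = (\<Sum>i\<in>UNIV. \<Sum>j\<in>UNIV. x $ i * y $ j * g i j)" for x y
  have fls_sum: "fps_to_fls (sum h A) = (\<Sum>i\<in>A. fps_to_fls (h i))" for h :: "'n \<Rightarrow> complex fps" and A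
    by (induction A rule: infinite_finite_induct) simp_all
  have B: "fps_to_fls (B x y) = fls_X ^ N * B' (\<iota> x) (\<iota> y)" for x y
    by (simp add: B_def B'_sum fls_sum fls_times_fps_to_fls g \<iota>_def sum_distrib_left mult.left_commute mult.assoc)
  have B_eqI: "B x y = B x' y'" if "B' (\<iota> x) (\<iota> y) = B' (\<iota> x') (\<iota> y')" for x y x' y'
    using that B by (metis fps_to_fls_eq_iff)
  have \<iota>_\<mu>: "\<iota> (\<mu> x y) = laurent_extension \<mu> (\<iota> x) (\<iota> y)" for x y
  proof -
    have "\<mu> x y = \<mu> (\<Sum>i\<in>UNIV. x $ i *s axis i 1) (\<Sum>j\<in>UNIV. y $ j *s axis j 1)"
      by (simp only: basis_expansion)
    also have "\<dots> = (\<Sum>i\<in>UNIV. \<Sum>j\<in>UNIV. (x $ i * y $ j) *s \<mu> (axis i 1) (axis j 1))"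
      unfolding hom_\<mu>[THEN module_hom.sum] hom_\<mu>[THEN module_hom.scale]
      by (subst sum.swap) (simp add: vec_eq_iff sum_distrib_left ac_simps)
    finally show ?thesis
      by (simp add: \<iota>_def laurent_extension_def vec_eq_iff fls_sum fls_times_fps_to_fls)
  qed
  have "bilinear_form B"
    unfolding bilinear_form_def
    by (intro conjI allI; unfold_locales)
      (simp_all add: B_def sum.distrib sum_distrib_left algebra_simps)
  moreover have "symmetric_form B"
    using B'(2) by (auto simp: symmetric_form_def intro: B_eqI)
  moreover have "invariant_form \<mu> B"
    using B'(4) by (auto simp: invariant_form_def \<iota>_\<mu> intro: B_eqI)
  moreover have "nondegenerate_form B"
    unfolding nondegenerate_form_def
  proof (intro allI impI)
    fix x assume x: "\<forall>y. B x y = 0"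
    \<comment> \<open>The standard basis already lies in the image of \<open>\<iota>\<close>, so
      orthogonality to power series vectors extends to all Laurent vectors.\<close>
    have basis: "B' (\<iota> x) (axis j 1) = 0" for j
    proof -
      have "\<iota> (axis j 1) = axis j 1"
        by (simp add: \<iota>_def axis_def vec_eq_iff)
      then show ?thesis using B[of x "axis j 1"] x by simp
    qed
    have "B' (\<iota> x) y = 0" for y
    proof -
      have "B' (\<iota> x) y = B' (\<iota> x) (\<Sum>j\<in>UNIV. y $ j *s axis j 1)"
        by (simp only: basis_expansion)
      also have "\<dots> = 0"
        by (simp add: hom_B'[THEN module_hom.sum] hom_B'[THEN module_hom.scale] basis)
      finally show ?thesis .
    qed
    then have "\<iota> x = 0"
      using B'(3) by (simp add: nondegenerate_form_def)
    then show "x = 0"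
      by (simp add: \<iota>_def vec_eq_iff)
  qed
  ultimately show ?thesis using that by blast
qed

text \<open>The matrix of the normalised basis carries the constant bracket to the deformed one. The
  equivalence is therefore its inverse \<open>H\<close>, whose constant term is the
  identity.\<close>

lemma trivial_deformationI:
  assumes "W3_star_lift (bracket_series \<phi>) B"
  shows "trivial_deformation W3_star \<phi>"
proof -
  interpret W3_star_lift "bracket_series \<phi>" B by fact
  obtain f where lift: "\<And>i. vec_coeff (f i) 0 = axis i 1"
    and table: "\<And>i j. bracket_series \<phi> (f i) (f j) =
       (if (i, j) = (3, 4) then f 2 else if (i, j) = (4, 3) then - f 2
        else if (i, j) = (3, 5) then f 1 else if (i, j) = (5, 3) then - f 1
        else if (i, j) = (4, 5) then f 3 else if (i, j) = (5, 4) then - f 3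
        else if (i, j) = (5, 5) then f 2 else if (i, j) = (4, 4) then f 1 else 0)"
    using W3_star_table_frame by blast
  obtain H where H: "H ** frame_matrix f = mat 1" "frame_matrix f ** H = mat 1" "coeff_matrix H 0 = mat 1"
    using inverse_frame_matrix[OF lift] .
  define \<Phi> where "\<Phi> = (\<lambda>k x. coeff_matrix H k *v x)"
  have \<Phi>: "linear_series \<Phi> = (\<lambda>x. H *v x)"
    by (simp add: \<Phi>_def linear_series_matrix)
  have inv: "inv (linear_series \<Phi>) = (\<lambda>x. frame_matrix f *v x)"
    unfolding \<Phi> by (rule inv_equality) (simp_all add: matrix_vector_mul_assoc H)
  have "bracket_series \<phi> (frame_matrix f *v x) (frame_matrix f *v y) =
      frame_matrix f *v bracket_series (constant_deformation W3_star) x y" for x y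
  proof -
    have t: "bracket_series \<phi> (f 3) (f 4) = f 2" "bracket_series \<phi> (f 4) (f 3) = - f 2"
      "bracket_series \<phi> (f 3) (f 5) = f 1" "bracket_series \<phi> (f 5) (f 3) = - f 1"
      "bracket_series \<phi> (f 4) (f 5) = f 3" "bracket_series \<phi> (f 5) (f 4) = - f 3"
      "bracket_series \<phi> (f 4) (f 4) = f 1" "bracket_series \<phi> (f 5) (f 5) = f 2"
      "bracket_series \<phi> (f 3) (f 3) = 0"
      "bracket_series \<phi> (f 1) (f i) = 0" "bracket_series \<phi> (f 2) (f i) = 0"
      "bracket_series \<phi> (f i) (f 1) = 0" "bracket_series \<phi> (f i) (f 2) = 0" for i
      by (simp_all add: table)
    show ?thesis
      unfolding frame_matrix_mult_vec sum_5 constant_deformation_W3_star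
      by (simp add: \<mu>_simps t vec_eq_iff algebra_simps)
  qed
  then have "bracket_series (constant_deformation W3_star) x y =
      linear_series \<Phi> (bracket_series \<phi> (inv (linear_series \<Phi>) x) (inv (linear_series \<Phi>) y))" for x y
    unfolding inv by (simp add: \<Phi> matrix_vector_mul_assoc H)
  moreover have "\<Phi> 0 = id"
    by (simp add: \<Phi>_def H fun_eq_iff)
  moreover have "module_hom (*s) (*s) (\<Phi> k)" for k
    unfolding \<Phi>_def
    by unfold_locales (simp_all add: matrix_vector_right_distrib vec.scale vec_eq_iff algebra_simps)
  ultimately show ?thesis
    unfolding trivial_deformation_def equivalent_deformations_def by blast
qed

theorem theorem5p7:
  shows "\<not> (\<exists>\<phi>. metric_deformation W3_star \<phi>)"
proof
  assume "\<exists>\<phi>. metric_deformation W3_star \<phi>"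
  then obtain \<phi> where \<phi>: "leibniz_deformation W3_star \<phi>" "\<not> trivial_deformation W3_star \<phi>"
    "metric_leibniz_algebra (laurent_extension (bracket_series \<phi>))"
    by (auto simp: metric_deformation_def)
  then have leibniz: "leibniz_algebra (bracket_series \<phi>)" and "\<phi> 0 = W3_star"
    by (auto simp: leibniz_deformation_def)
  then obtain B where "bilinear_form B" "symmetric_form B" "nondegenerate_form B"
    "invariant_form (bracket_series \<phi>) B"
    using laurent_form_lattice \<phi>(3) by (metis leibniz_algebra_def)
  with leibniz \<open>\<phi> 0 = W3_star\<close> have "W3_star_lift (bracket_series \<phi>) B"
    by unfold_locales
      (auto simp: bracket_series_coeff_0 symmetric_form_def nondegenerate_form_def invariant_form_def)
  with \<phi>(2) show False using trivial_deformationI by blast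
qed

end
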